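(* Let $A$ be a bounded subset of a Banach lattice $E$. Then $A$ is disjointly weakly compact if and only if every disjoint sequence $(x_n)\subset Sol(A)$ is weakly Cauchy.
   Context: Banach lattices are real. A sequence $(x_n)$ in a Banach lattice is disjoint if $|x_n|\wedge|x_m|=0$ for $n\neq m$. $Sol(A)=\{x\in E: |x|\le |a| \text{ for some } a\in A\}$ is the solid hull of $A$. A norm bounded set $A\subset E$ is disjointly weakly compact if every disjoint sequence $(x_n)\subset Sol(A)$ converges weakly to zero. A sequence $(x_n)$ is weakly Cauchy if $(f(x_n))$ converges for every $f\in E'$. *)

theory Defs
  imports "HOL-Analysis.Analysis" "HOL-Library.Lattice_Algebras"
begin

class banach_lattice = banach + ordered_real_vector + lattice_ab_group_add_abs +
  assumes norm_lattice_mono: "\<bar>x\<bar> \<le> \<bar>y\<bar> \<Longrightarrow> norm x \<le> norm y"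

instance real :: banach_lattice
  by standard (auto simp: sup_real_def abs_if)

definition disjoint_seq :: "(nat \<Rightarrow> 'a::banach_lattice) \<Rightarrow> bool" where
  "disjoint_seq x \<longleftrightarrow> (\<forall>n m. n \<noteq> m \<longrightarrow> inf \<bar>x n\<bar> \<bar>x m\<bar> = 0)"

definition solid_hull :: "'a::banach_lattice set \<Rightarrow> 'a set" where
  "solid_hull A = {x. \<exists>a\<in>A. \<bar>x\<bar> \<le> \<bar>a\<bar>}"

text \<open>The dual space consists of the norm-continuous linear functionals, i.e. the
  real-valued functions satisfying \<^const>\<open>bounded_linear\<close>.\<close>

definition weakly_convergent_to :: "(nat \<Rightarrow> 'a::real_normed_vector) \<Rightarrow> 'a \<Rightarrow> bool" where
  "weakly_convergent_to x l \<longleftrightarrow>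
    (\<forall>f :: 'a \<Rightarrow> real. bounded_linear f \<longrightarrow> (\<lambda>n. f (x n)) \<longlonglongrightarrow> f l)"

definition weakly_Cauchy :: "(nat \<Rightarrow> 'a::real_normed_vector) \<Rightarrow> bool" where
  "weakly_Cauchy x \<longleftrightarrow>
    (\<forall>f :: 'a \<Rightarrow> real. bounded_linear f \<longrightarrow> convergent (\<lambda>n. f (x n)))"

definition disjointly_weakly_compact :: "'a::banach_lattice set \<Rightarrow> bool" where
  "disjointly_weakly_compact A \<longleftrightarrow> bounded A \<and>
    (\<forall>x. disjoint_seq x \<and> range x \<subseteq> solid_hull A \<longrightarrow> weakly_convergent_to x 0)"

end

theory Submission
  imports Defs
begin

text \<open>Flipping the signs of a disjoint sequence in \<open>Sol(A)\<close> keeps it disjoint and in \<open>Sol(A)\<close>.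
  So \<open>f (x\<^sub>n)\<close> and \<open>(-1)\<^sup>n f (x\<^sub>n)\<close> both converge, which forces the limit to be \<open>0\<close>.\<close>

text \<open>Along even indices the factor \<open>(-1) ^ n\<close> is 1, so both sequences have the
  same limit; along odd indices it is -1, so the limits are opposite. Hence
  \<open>l = m = - l\<close>.\<close>

lemma LIMSEQ_zero_if_alternating_convergent:
  fixes u :: "nat \<Rightarrow> real"
  assumes "convergent u" and "convergent (\<lambda>n. (-1) ^ n * u n)"
  shows "u \<longlonglongrightarrow> 0"
proof -
  obtain l m where l: "u \<longlonglongrightarrow> l" and m: "(\<lambda>n. (-1) ^ n * u n) \<longlonglongrightarrow> m"
    using assms by (auto simp: convergent_def)
  have even: "strict_mono (\<lambda>n::nat. 2 * n)" and odd: "strict_mono (\<lambda>n::nat. Suc (2 * n))"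
    by (auto simp: strict_mono_def)
  have "(\<lambda>n. u (2 * n)) \<longlonglongrightarrow> m"
    using LIMSEQ_subseq_LIMSEQ[OF m even] by (simp add: o_def)
  then have "l = m"
    using LIMSEQ_subseq_LIMSEQ[OF l even] LIMSEQ_unique by (fastforce simp: o_def)
  have "(\<lambda>n. - u (Suc (2 * n))) \<longlonglongrightarrow> m"
    using LIMSEQ_subseq_LIMSEQ[OF m odd] by (simp add: o_def)
  moreover have "(\<lambda>n. - u (Suc (2 * n))) \<longlonglongrightarrow> - l"
    using LIMSEQ_subseq_LIMSEQ[OF l odd] by (auto simp: o_def intro: tendsto_minus)
  ultimately have "m = - l"
    by (rule LIMSEQ_unique)
  with \<open>l = m\<close> l show ?thesis
    by simp
qed

lemma abs_alternating_scaleR: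
  fixes x :: "'a::banach_lattice"
  shows "\<bar>(-1) ^ n *\<^sub>R x\<bar> = \<bar>x\<bar>"
  by (cases "even n") simp_all

theorem theorem2p5:
  fixes A :: "'a::banach_lattice set"
  assumes "bounded A"
  shows "disjointly_weakly_compact A \<longleftrightarrow>
    (\<forall>x. disjoint_seq x \<and> range x \<subseteq> solid_hull A \<longrightarrow> weakly_Cauchy x)"
proof
  assume "disjointly_weakly_compact A"
  then show "\<forall>x. disjoint_seq x \<and> range x \<subseteq> solid_hull A \<longrightarrow> weakly_Cauchy x"
    unfolding disjointly_weakly_compact_def weakly_convergent_to_def weakly_Cauchy_def
    by (blast intro: convergentI)
next
  assume cauchy: "\<forall>x. disjoint_seq x \<and> range x \<subseteq> solid_hull A \<longrightarrow> weakly_Cauchy x"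
  have "weakly_convergent_to x 0"
    if disj: "disjoint_seq x" and sol: "range x \<subseteq> solid_hull A" for x
    unfolding weakly_convergent_to_def
  proof (intro allI impI)
    fix f :: "'a \<Rightarrow> real"
    assume f: "bounded_linear f"
    interpret f: bounded_linear f by (fact f)
    let ?y = "\<lambda>n. (-1) ^ n *\<^sub>R x n"
    \<comment> \<open>Both properties see a sequence only through the absolute values of its terms,
      and those of \<open>?y n\<close> and \<open>x n\<close> agree.\<close>
    have "disjoint_seq ?y" "range ?y \<subseteq> solid_hull A"
      using disj sol
      by (auto simp: disjoint_seq_def solid_hull_def image_subset_iff abs_alternating_scaleR)
    then have "convergent (\<lambda>n. f (?y n))"
      using cauchy f unfolding weakly_Cauchy_def by blast
    moreover have "convergent (\<lambda>n. f (x n))"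
      using cauchy disj sol f unfolding weakly_Cauchy_def by blast
    \<comment> \<open>Linearity turns \<open>f (?y n)\<close> into \<open>(-1) ^ n * f (x n)\<close>
      and \<open>f 0\<close> into 0, the form needed for the alternating-sign lemma with
      \<open>u n = f (x n)\<close>.\<close>
    ultimately show "(\<lambda>n. f (x n)) \<longlonglongrightarrow> f 0"
      using LIMSEQ_zero_if_alternating_convergent by (simp add: f.scaleR f.zero)
  qed
  \<comment> \<open>\<open>assms\<close> supplies the boundedness conjunct of the
    definition.\<close>
  with assms show "disjointly_weakly_compact A"
    by (auto simp: disjointly_weakly_compact_def)
qed

end
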